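(* Let $n \geq 2$ be an integer, let $\alpha = \alpha_n$ be the positive real zero of the polynomial $X^n - X^{n-1} - \cdots - X - 1$, and let $\beta = 1/\alpha$. Then: (a) $$\beta = \frac12 + \frac12 \sum_{k\ge 1} \frac1k \binom{k(n+1)}{k-1} \frac{1}{2^{k(n+1)}}.$$ (b) $$\alpha = 2 - 2 \sum_{k\ge 1} \frac1k \binom{k(n+1)-2}{k-1} \frac{1}{2^{k(n+1)}}.$$ (c) $$\frac{1}{2-\alpha} = 2^n - \frac n2 - \frac12 \sum_{k\ge 1} \frac1k \binom{k(n+1)}{k+1} \frac{1}{2^{k(n+1)}}.$$
   Context: For $n \ge 2$ the polynomial is $X^n - \sum_{j=0}^{n-1} X^j$. It is well known that it has exactly one positive real zero, denoted $\alpha_n$, and that $1 < \alpha_n < 2$. All sums run over integers $k \ge 1$, the series are (convergent) infinite series of real numbers, and $\binom{a}{b}$ is the usual binomial coefficient. *)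

theory Defs
  imports "HOL-Analysis.Analysis" "HOL-Computational_Algebra.Polynomial"
begin

definition nbonacci_poly :: "nat \<Rightarrow> real poly" where
  "nbonacci_poly n = monom 1 n - (\<Sum>j<n. monom 1 j)"

definition nbonacci_const :: "nat \<Rightarrow> real" where
  "nbonacci_const n = (THE x. x > 0 \<and> poly (nbonacci_poly n) x = 0)"

text \<open>The definite description is well-defined, and the zero lies strictly between 1 and 2.\<close>

lemma poly_nbonacci_poly: "poly (nbonacci_poly n) x = x ^ n - (\<Sum>j<n. x ^ j)"
  by (simp add: nbonacci_poly_def poly_sum poly_monom)

lemma nbonacci_poly_root_unique:
  assumes n: "n \<ge> 1" and x: "0 < x" "poly (nbonacci_poly n) x = 0"
    and y: "0 < y" "poly (nbonacci_poly n) y = 0"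
  shows "x = y"
proof -
  have not_less: False
    if "0 < a" "a < b" "poly (nbonacci_poly n) a = 0" "poly (nbonacci_poly n) b = 0" for a b :: real
  proof -
    have ea: "a ^ n = (\<Sum>j<n. a ^ j)" and eb: "b ^ n = (\<Sum>j<n. b ^ j)"
      using that by (auto simp: poly_nbonacci_poly)
    have "b ^ j * a ^ n < a ^ j * b ^ n" if "j < n" for j
    proof -
      have "a ^ (n - j) < b ^ (n - j)"
        using \<open>0 < a\<close> \<open>a < b\<close> that by (intro power_strict_mono) auto
      then have "(a ^ j * b ^ j) * a ^ (n - j) < (a ^ j * b ^ j) * b ^ (n - j)"
        using \<open>0 < a\<close> \<open>a < b\<close> by (intro mult_strict_left_mono) auto
      moreover have "a ^ n = a ^ j * a ^ (n - j)" "b ^ n = b ^ j * b ^ (n - j)"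
        using that by (simp_all flip: power_add)
      ultimately show ?thesis by (simp add: mult_ac)
    qed
    then have "(\<Sum>j<n. b ^ j * a ^ n) < (\<Sum>j<n. a ^ j * b ^ n)"
      using n by (intro sum_strict_mono) (auto simp: lessThan_empty_iff bot_nat_def)
    then have "(\<Sum>j<n. b ^ j) * a ^ n < (\<Sum>j<n. a ^ j) * b ^ n"
      by (simp add: sum_distrib_right)
    then show False
      unfolding ea[symmetric] eb[symmetric] by (simp add: mult.commute)
  qed
  show ?thesis
    using not_less[of x y] not_less[of y x] x y by (cases x y rule: linorder_cases) auto
qed

lemma nbonacci_poly_root_exists:
  assumes n: "n \<ge> 2"
  shows "\<exists>x. 1 < x \<and> x < 2 \<and> poly (nbonacci_poly n) x = 0"
proof -
  have "poly (nbonacci_poly n) 1 < 0"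
    using n by (simp add: poly_nbonacci_poly)
  moreover have "(\<Sum>j<n. 2 ^ j) = (2 ^ n - 1 :: real)"
    by (induction n) auto
  then have "poly (nbonacci_poly n) 2 > 0"
    by (simp add: poly_nbonacci_poly)
  ultimately show ?thesis
    using poly_IVT_pos[of 1 2 "nbonacci_poly n"] by auto
qed

lemma nbonacci_const:
  assumes "n \<ge> 2"
  shows "1 < nbonacci_const n" "nbonacci_const n < 2"
    "poly (nbonacci_poly n) (nbonacci_const n) = 0"
proof -
  obtain x where x: "1 < x" "x < 2" "poly (nbonacci_poly n) x = 0"
    using nbonacci_poly_root_exists[OF assms] by blast
  have "nbonacci_const n = x"
    unfolding nbonacci_const_def
    using x assms nbonacci_poly_root_unique[of n _ x] by (intro the_equality) auto
  with x show "1 < nbonacci_const n" "nbonacci_const n < 2"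
    "poly (nbonacci_poly n) (nbonacci_const n) = 0" by auto
qed

end

theory Submission
  imports Defs
begin

text \<open>
Since \<open>\<alpha> ^ n = \<Sum>j<n. \<alpha> ^ j\<close>, the number \<open>\<beta> = 1 / \<alpha>\<close> satisfies \<open>2 * \<beta> = 1 + \<beta> ^ (n + 1)\<close>. This is the
equation of a random walk on the natural numbers that steps down by \<open>1\<close> or up by \<open>n\<close>, each with
probability \<open>1/2\<close>: it says that \<open>h \<mapsto> \<beta> ^ h\<close> is harmonic for the walk. As \<open>\<beta> < 1\<close>, the power \<open>\<beta> ^ h\<close>
is the probability that the walk started at \<open>h\<close> ever reaches \<open>0\<close>. Classifying the walks from \<open>h\<close> to
\<open>0\<close> by their number \<open>k\<close> of up-steps, which forces \<open>h + n * k\<close> down-steps, yields (lemma \<open>hit_sums\<close>)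

  \<open>\<beta> ^ h = (\<Sum>k. walks n h k / 2 ^ (h + (n + 1) * k))\<close>.

No estimate of the radius of convergence of a power series is involved. The terms are nonnegative
and their partial sums stay below \<open>\<beta> ^ h\<close> by induction, so the series converge. Their limits are
harmonic in \<open>h\<close> as well and agree with \<open>\<beta> ^ h\<close> at \<open>h = 0\<close>, so a maximum principle for harmonic
functions tending to \<open>0\<close> forces equality everywhere.

A ballot formula (lemma \<open>walks_ballot\<close>) expresses the number of walks as a difference of two binomial
coefficients, and each of the three expansions is one way of specialising \<open>h\<close>. The first is \<open>h = 1\<close>.
The second is \<open>h = n\<close>, because \<open>\<alpha> = 2 - \<beta> ^ n\<close>. For the third, \<open>1 / (2 - \<alpha>) = \<alpha> ^ n\<close> has a negative
exponent in \<open>\<beta>\<close>, but the equation for \<open>\<beta>\<close> turns it into a combination of positive ones,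
\<open>\<alpha> ^ n = 2 ^ n - (\<Sum>i<n. 2 ^ i * \<beta> ^ (i + 1))\<close>, and the powers of \<open>2\<close> are just those that make the
walk counts for the heights \<open>1, \<dots>, n\<close> add up unweighted, to a single binomial coefficient.
\<close>

section \<open>Counting the walks\<close>

text \<open>
The number of walks from height \<open>h\<close> that first reach \<open>0\<close> at their end, with steps \<open>-1\<close> and \<open>+n\<close>, of
which \<open>k\<close> are \<open>+n\<close>. The recursion removes the first step; an up-step from \<open>h + 1\<close> leads to
\<open>h + (n + 1)\<close>.
\<close>
fun walks :: "nat \<Rightarrow> nat \<Rightarrow> nat \<Rightarrow> nat" where
  "walks n h 0 = 1"
| "walks n 0 (Suc k) = 0"
| "walks n (Suc h) (Suc k) = walks n h (Suc k) + walks n (h + (n + 1)) k"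

lemma binomial_ratio: "Suc k * (k + d choose Suc k) = d * (k + d choose k)"
  using binomial_absorb_comp[of "k + d" k] binomial_absorption[of k "k + d"] by simp

text \<open>
For \<open>k\<close> up-steps and \<open>N = (n + 1) * k + h\<close> steps in all, the count is the ballot number
\<open>h / N * (N choose k)\<close>, which equals \<open>(N - 1 choose k) - n * (N - 1 choose (k - 1))\<close> for \<open>k \<ge> 1\<close>. In the
second form both binomial coefficients obey Pascal's rule in step with the recursion of \<open>walks\<close>, and
only the boundary \<open>h = 0\<close> needs the ratio of neighbouring coefficients.
\<close>
lemma walks_ballot:
  "walks n h (Suc k) + n * ((n + 1) * k + n + h choose k) = ((n + 1) * k + n + h choose Suc k)"
proof (induction n h "Suc k" arbitrary: k rule: walks.induct)
  case (2 n k)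
  have "Suc k * ((n + 1) * k + n choose Suc k) = Suc k * (n * ((n + 1) * k + n choose k))"
    using binomial_ratio[of k "n * Suc k"] by (simp add: algebra_simps)
  then show ?case by (simp only: nat_mult_eq_cancel_disj) simp
next
  case (3 n h k)
  show ?case
  proof (cases k)
    case 0
    then show ?thesis using "3.hyps"(1) by simp
  next
    case (Suc j)
    have "walks n (h + (n + 1)) k + n * ((n + 1) * k + n + h choose j) = ((n + 1) * k + n + h choose k)"
      using "3.hyps"(2)[OF Suc] Suc by (simp add: algebra_simps)
    then show ?thesis using "3.hyps"(1) Suc by (simp add: algebra_simps)
  qed
qed

lemma walks_one: "Suc k * walks n 1 (Suc k) = (Suc k * (n + 1) choose k)"
proof -
  have "walks n 1 (Suc k) + n * (Suc k * (n + 1) choose k) = (Suc k * (n + 1) choose Suc k)"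
    using walks_ballot[of n 1 k] by (simp add: algebra_simps)
  moreover have "Suc k * (Suc k * (n + 1) choose Suc k) = (n * Suc k + 1) * (Suc k * (n + 1) choose k)"
    using binomial_ratio[of k "n * Suc k + 1"] by (simp add: algebra_simps)
  ultimately have "Suc k * (walks n 1 (Suc k) + n * (Suc k * (n + 1) choose k))
      = (n * Suc k + 1) * (Suc k * (n + 1) choose k)" by simp
  then show ?thesis by (simp add: algebra_simps del: walks.simps)
qed

lemma walks_up_step:
  assumes "n \<ge> 1"
  shows "Suc k * walks n n k = (Suc k * (n + 1) - 2 choose k)"
proof (cases k)
  case (Suc j)
  define N where "N = Suc k * (n + 1) - 2"
  have N: "N = (n + 1) * j + n + n" "N = j + n * Suc k"
    using assms Suc by (auto simp: N_def algebra_simps)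
  have "walks n n k + n * (N choose j) = (N choose k)"
    using walks_ballot[of n n j] N(1) Suc by simp
  moreover have "Suc j * (N choose Suc j) = n * Suc k * (N choose j)"
    using binomial_ratio[of j "n * Suc k"] N(2) by simp
  ultimately have "Suc k * (walks n n k + n * (N choose j)) = (N choose k) + n * Suc k * (N choose j)"
    using Suc by simp
  then show ?thesis unfolding N_def[symmetric] by (simp add: algebra_simps)
qed simp

lemma sum_choose_shift: "(\<Sum>i<j. (N + i choose k)) + (N choose Suc k) = (N + j choose Suc k)"
  by (induction j) auto

text \<open>
Summing the ballot formula over the heights \<open>1, \<dots>, n\<close> telescopes to the end points \<open>N\<close> and
\<open>M = N + n\<close>. The contributions of \<open>M\<close> cancel, since \<open>M + 1 = (n + 1) * (k + 2)\<close>.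
\<close>
lemma sum_walks:
  "Suc k * (\<Sum>i<n. walks n (Suc i) (Suc k)) = (Suc k * (n + 1) choose (Suc k + 1))"
proof -
  define N M where "N = Suc k * (n + 1)" and "M = N + n"
  let ?S = "\<Sum>i<n. walks n (Suc i) (Suc k)"
  have "walks n (Suc i) (Suc k) + n * (N + i choose k) = (N + i choose Suc k)" for i
    using walks_ballot[of n "Suc i" k] by (simp add: N_def algebra_simps del: walks.simps)
  then have "?S + n * (\<Sum>i<n. (N + i choose k)) = (\<Sum>i<n. (N + i choose Suc k))"
    by (simp add: sum.distrib[symmetric] sum_distrib_left del: walks.simps)
  moreover have "n * (\<Sum>i<n. (N + i choose k)) + n * (N choose Suc k) = n * (M choose Suc k)"
    unfolding M_def sum_choose_shift[of N k n, symmetric] by (rule add_mult_distrib2[symmetric])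
  moreover have "(\<Sum>i<n. (N + i choose Suc k)) + (N choose Suc (Suc k)) = (M choose Suc (Suc k))"
    unfolding M_def by (rule sum_choose_shift)
  moreover have "(M choose Suc (Suc k)) = n * (M choose Suc k)"
  proof -
    have "Suc (Suc k) * (M choose Suc (Suc k)) = Suc (Suc k) * (n * (M choose Suc k))"
      using binomial_ratio[of "Suc k" "n * Suc (Suc k)"]
      by (simp add: M_def N_def algebra_simps)
    then show ?thesis by (simp only: nat_mult_eq_cancel_disj) simp
  qed
  ultimately have "?S + (N choose Suc (Suc k)) = n * (N choose Suc k)"
    by linarith
  then have "Suc k * ?S + Suc k * (N choose Suc (Suc k)) = n * Suc k * (N choose Suc k)"
    by (simp only: mult.assoc mult.left_commute[of n] flip: add_mult_distrib2)
  moreover have "Suc (Suc k) * (N choose Suc (Suc k)) = n * Suc k * (N choose Suc k)"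
    using binomial_ratio[of "Suc k" "n * Suc k"] by (simp add: N_def algebra_simps)
  ultimately show ?thesis by (simp add: N_def algebra_simps)
qed

section \<open>Hitting probabilities\<close>

text \<open>
The probability that the fair walk with steps \<open>-1\<close> and \<open>+n\<close>, started at \<open>h\<close>, first reaches \<open>0\<close> after
exactly \<open>k\<close> up-steps: such a walk has \<open>h + n * k\<close> down-steps.
\<close>
definition hit :: "nat \<Rightarrow> nat \<Rightarrow> nat \<Rightarrow> real" where
  "hit n h k = walks n h k / 2 ^ (h + (n + 1) * k)"

lemma hit_nonneg: "hit n h k \<ge> 0"
  by (simp add: hit_def)

lemma hit_zero_up_steps: "hit n h 0 = 1 / 2 ^ h"
  by (simp add: hit_def)

lemma hit_down: "hit n (Suc h) 0 = hit n h 0 / 2"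
  by (simp add: hit_def)

lemma hit_step: "hit n (Suc h) (Suc k) = (hit n h (Suc k) + hit n (h + (n + 1)) k) / 2"
  by (simp add: hit_def power_add field_simps)

lemma sum_hit_step:
  "(\<Sum>k<Suc K. hit n (Suc h) k) = ((\<Sum>k<Suc K. hit n h k) + (\<Sum>k<K. hit n (h + (n + 1)) k)) / 2"
  by (simp only: sum.lessThan_Suc_shift hit_down hit_step flip: sum_divide_distrib)
    (simp add: sum.distrib add_divide_distrib flip: sum_divide_distrib)

text \<open>
The value \<open>\<beta> ^ h\<close> is a harmonic function of the starting height that is nonnegative and equals \<open>1\<close> at
\<open>0\<close>, hence it bounds the probability of reaching \<open>0\<close> with fewer than \<open>K\<close> up-steps. The outer
induction, on the number of up-steps, is needed because an up-step increases \<open>h\<close>.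
\<close>
lemma sum_hit_le:
  assumes "0 < \<beta>" "2 * \<beta> = 1 + \<beta> ^ (n + 1)"
  shows "(\<Sum>k<K. hit n h k) \<le> \<beta> ^ h"
proof (induction K arbitrary: h)
  case 0
  then show ?case using assms by simp
next
  case (Suc K)
  note K = this
  show ?case
  proof (induction h)
    case 0
    then show ?case by (simp add: sum.lessThan_Suc_shift hit_def del: sum.lessThan_Suc)
  next
    case (Suc h)
    have "(\<Sum>k<Suc K. hit n (Suc h) k) \<le> (\<beta> ^ h + \<beta> ^ (h + (n + 1))) / 2"
      unfolding sum_hit_step using Suc K[of "h + (n + 1)"] by simp
    also have "\<dots> = \<beta> ^ h * (1 + \<beta> ^ (n + 1)) / 2"
      unfolding power_add by (simp add: algebra_simps)
    also have "\<dots> = \<beta> ^ Suc h"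
      unfolding assms(2)[symmetric] by simp
    finally show ?case .
  qed
qed

text \<open>
A positive value would produce a positive maximum, as \<open>D\<close> tends to \<open>0\<close>. At the least place where the
maximum is attained, which is not \<open>0\<close>, the mean value property makes \<open>D\<close> maximal one place below.
\<close>
lemma maximum_principle:
  fixes D :: "nat \<Rightarrow> real"
  assumes "D 0 = 0" "D \<longlonglongrightarrow> 0" and step: "\<And>h. D (Suc h) = (D h + D (h + m)) / 2"
  shows "D h \<le> 0"
proof (rule ccontr)
  assume "\<not> D h \<le> 0"
  then have "eventually (\<lambda>i. D i < D h) sequentially"
    using assms(2) by (intro order_tendstoD) auto
  then obtain N where N: "\<And>i. i \<ge> N \<Longrightarrow> D i < D h"
    by (auto simp: eventually_sequentially)
  define s where "s = Max (D ` {..N + h})"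
  have s: "s \<in> D ` {..N + h}" "D h \<le> s"
    unfolding s_def by (rule Max_in, simp, simp) (rule Max_ge, auto)
  have le: "D i \<le> s" for i
  proof (cases "i \<le> N + h")
    case True
    then show ?thesis unfolding s_def by (intro Max_ge) auto
  next
    case False
    then show ?thesis using N[of i] s(2) by simp
  qed
  define i where "i = (LEAST i. D i = s)"
  have i: "D i = s"
    using s(1) unfolding i_def by (metis (mono_tags, lifting) LeastI image_iff)
  have "i \<noteq> 0"
    by (rule notI) (use i s(2) \<open>\<not> D h \<le> 0\<close> assms(1) in simp)
  then obtain j where j: "i = Suc j"
    using not0_implies_Suc by blast
  have "D j \<noteq> s"
    using not_less_Least[of j "\<lambda>i. D i = s"] j i_def by auto
  then show False
    using le[of j] le[of "j + m"] step[of j] i j by simp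
qed

text \<open>
The defect \<open>D h\<close> between \<open>\<beta> ^ h\<close> and the sum of the series is nonnegative by \<open>sum_hit_le\<close>. It is harmonic
and at most \<open>\<beta> ^ h\<close>, which tends to \<open>0\<close>, so the maximum principle shows that it vanishes. The condition
\<open>\<beta> < 1\<close> is what distinguishes \<open>\<beta>\<close> from the root \<open>1\<close> of the equation.
\<close>
theorem hit_sums:
  assumes "0 < \<beta>" "\<beta> < 1" "2 * \<beta> = 1 + \<beta> ^ (n + 1)"
  shows "hit n h sums \<beta> ^ h"
proof -
  have summable: "summable (hit n h)" for h
    by (rule summableI_nonneg_bounded[OF hit_nonneg sum_hit_le[OF assms(1,3)]])
  define F where "F h = (\<Sum>k. hit n h k)" for h
  have F: "hit n h sums F h" for h
    unfolding F_def using summable by (rule summable_sums)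
  have le: "F h \<le> \<beta> ^ h" for h
    unfolding F_def using suminf_le_const[OF summable sum_hit_le[OF assms(1,3)]] .
  have ge: "F h \<ge> 0" for h
    unfolding F_def by (rule suminf_nonneg[OF summable hit_nonneg])
  have "F 0 = 1"
  proof -
    have "hit n 0 = (\<lambda>k. if k = 0 then 1 else 0)"
    proof
      show "hit n 0 k = (if k = 0 then 1 else 0)" for k
        by (cases k) (simp_all add: hit_def)
    qed
    then have "hit n 0 sums 1"
      using sums_single[of 0 "\<lambda>_. 1 :: real"] by simp
    then show ?thesis
      using F[of 0] by (rule sums_unique2[symmetric])
  qed
  have F_step: "F (Suc h) = (F h + F (h + (n + 1))) / 2" for h
  proof -
    have "(\<lambda>k. hit n h (Suc k)) sums (F h - hit n h 0)"
      using F[of h] by (simp add: sums_Suc_iff)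
    from sums_divide[OF sums_add[OF this F[of "h + (n + 1)"]], of 2]
    have "(\<lambda>k. hit n (Suc h) (Suc k)) sums ((F h - hit n h 0 + F (h + (n + 1))) / 2)"
      by (simp only: hit_step)
    then have "hit n (Suc h) sums ((F h - hit n h 0 + F (h + (n + 1))) / 2 + hit n (Suc h) 0)"
      by (simp only: sums_Suc_iff)
    from sums_unique2[OF F[of "Suc h"] this] show ?thesis
      by (simp add: hit_down field_simps)
  qed
  define D where "D h = \<beta> ^ h - F h" for h
  have "D h \<le> 0"
  proof (rule maximum_principle)
    show "D 0 = 0" by (simp add: D_def \<open>F 0 = 1\<close>)
    have "(\<lambda>h. \<beta> ^ h) \<longlonglongrightarrow> 0"
      using assms by (intro LIMSEQ_power_zero) auto
    then show "D \<longlonglongrightarrow> 0"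
      by (rule tendsto_sandwich[rotated 3, OF _ _ _ tendsto_const])
        (use le ge in \<open>auto simp: D_def\<close>)
    fix h
    have "\<beta> ^ Suc h = (\<beta> ^ h + \<beta> ^ (h + (n + 1))) / 2"
    proof -
      have "2 * \<beta> ^ Suc h = \<beta> ^ h * (2 * \<beta>)" by simp
      also have "\<dots> = \<beta> ^ h + \<beta> ^ (h + (n + 1))"
        unfolding assms(3) power_add by (simp add: algebra_simps)
      finally show ?thesis by simp
    qed
    then show "D (Suc h) = (D h + D (h + (n + 1))) / 2"
      unfolding D_def F_step by (simp add: field_simps)
  qed
  then have "F h = \<beta> ^ h" using le[of h] by (simp add: D_def)
  then show ?thesis using F by metis
qed

section \<open>The three expansions\<close>

lemma nbonacci_const_inverse:
  assumes "n \<ge> 2"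
  defines "\<beta> \<equiv> 1 / nbonacci_const n"
  shows "0 < \<beta>" "\<beta> < 1" "2 * \<beta> = 1 + \<beta> ^ (n + 1)"
proof -
  define a where "a = nbonacci_const n"
  have a: "1 < a" "a < 2" and root: "a ^ n = (\<Sum>j<n. a ^ j)"
    using nbonacci_const[OF assms(1)] by (auto simp: a_def poly_nbonacci_poly)
  show "0 < \<beta>" "\<beta> < 1" using a by (auto simp: \<beta>_def a_def)
  have "a ^ n = (a ^ n - 1) / (a - 1)"
    using root geometric_sum[of a n] a by simp
  then have "2 * a ^ n = a ^ (n + 1) + 1"
    using a by (simp add: field_simps)
  then show "2 * \<beta> = 1 + \<beta> ^ (n + 1)"
    using a by (simp add: \<beta>_def a_def[symmetric] field_simps)
qed

theorem theorem1:
  fixes n :: nat and \<alpha> \<beta> :: real and A B C :: "nat \<Rightarrow> real"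
  assumes "n \<ge> 2"
  defines "\<alpha> \<equiv> nbonacci_const n"
    and "\<beta> \<equiv> 1 / \<alpha>"
    and "A \<equiv> \<lambda>k. 1 / real k * real ((k * (n + 1)) choose (k - 1)) * (1 / 2 ^ (k * (n + 1)))"
    and "B \<equiv> \<lambda>k. 1 / real k * real ((k * (n + 1) - 2) choose (k - 1)) * (1 / 2 ^ (k * (n + 1)))"
    and "C \<equiv> \<lambda>k. 1 / real k * real ((k * (n + 1)) choose (k + 1)) * (1 / 2 ^ (k * (n + 1)))"
  shows "(summable (\<lambda>i. A (Suc i)) \<and> \<beta> = 1 / 2 + 1 / 2 * (\<Sum>i. A (Suc i))) \<and>
         (summable (\<lambda>i. B (Suc i)) \<and> \<alpha> = 2 - 2 * (\<Sum>i. B (Suc i))) \<and>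
         (summable (\<lambda>i. C (Suc i)) \<and>
           1 / (2 - \<alpha>) = 2 ^ n - real n / 2 - 1 / 2 * (\<Sum>i. C (Suc i)))"
proof -
  have \<beta>: "0 < \<beta>" "\<beta> < 1" "2 * \<beta> = 1 + \<beta> ^ (n + 1)"
    unfolding \<beta>_def \<alpha>_def using nbonacci_const_inverse[OF assms(1)] by blast+
  have \<alpha>\<beta>: "\<alpha> = 1 / \<beta>" by (simp add: \<beta>_def)
  have \<alpha>: "\<alpha> = 2 - \<beta> ^ n"
    using \<beta> by (simp add: \<alpha>\<beta> field_simps)
  note sums = hit_sums[OF \<beta>]
  have "A (Suc k) = 2 * hit n 1 (Suc k)" for k
  proof -
    have "real (Suc k) * real (walks n 1 (Suc k)) = real (Suc k * (n + 1) choose k)"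
      by (simp only: walks_one flip: of_nat_mult)
    then show ?thesis
      unfolding A_def hit_def by (simp add: field_simps del: walks.simps of_nat_Suc)
  qed
  moreover have "(\<lambda>k. 2 * hit n 1 (Suc k)) sums (2 * (\<beta> - 1 / 2))"
    using sums[of 1] by (intro sums_mult) (simp add: sums_Suc_iff hit_zero_up_steps)
  ultimately have A: "(\<lambda>k. A (Suc k)) sums (2 * \<beta> - 1)"
    by (simp add: algebra_simps)
  \<comment> \<open>Of the extra exponent \<open>n + 1\<close> at \<open>Suc k\<close>, the starting height takes \<open>n\<close> and the factor \<open>1/2\<close> the rest.\<close>
  have "B (Suc k) = hit n n k / 2" for k
  proof -
    have "real (Suc k) * real (walks n n k) = real (Suc k * (n + 1) - 2 choose k)"
      using assms(1) by (simp only: walks_up_step flip: of_nat_mult)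
    then show ?thesis
      unfolding B_def hit_def
      by (simp add: field_simps power_add del: walks.simps of_nat_Suc)
  qed
  then have B: "(\<lambda>k. B (Suc k)) sums (\<beta> ^ n / 2)"
    using sums_divide[OF sums[of n], of 2] by (simp only:)
  \<comment> \<open>The weight \<open>2 ^ i\<close> cancels the dependence on the height in the denominator \<open>2 ^ (Suc i + (n + 1) * k)\<close>.\<close>
  define G where "G k = (\<Sum>i<n. 2 ^ i * hit n (Suc i) k)" for k
  have "C (Suc k) = 2 * G (Suc k)" for k
  proof -
    have "2 * G (Suc k) = (\<Sum>i<n. real (walks n (Suc i) (Suc k))) / 2 ^ (Suc k * (n + 1))"
      unfolding G_def hit_def sum_distrib_left sum_divide_distrib
      by (rule sum.cong) (simp_all add: field_simps power_add del: walks.simps)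
    moreover have "real (Suc k) * (\<Sum>i<n. real (walks n (Suc i) (Suc k)))
        = real (Suc k * (n + 1) choose (Suc k + 1))"
      by (simp only: sum_walks flip: of_nat_mult of_nat_sum)
    ultimately show ?thesis
      unfolding C_def by (simp add: field_simps del: walks.simps of_nat_Suc)
  qed
  moreover have "G 0 = n / 2"
    by (simp add: G_def hit_zero_up_steps)
  moreover have "(\<Sum>i<n. 2 ^ i * \<beta> ^ Suc i) = 2 ^ n - \<alpha> ^ n"
  proof -
    have "(\<Sum>i<n. 2 ^ i * \<beta> ^ Suc i) = \<beta> * (\<Sum>i<n. (2 * \<beta>) ^ i)"
      by (simp add: sum_distrib_left power_mult_distrib algebra_simps)
    also have "\<dots> = \<beta> * (((2 * \<beta>) ^ n - 1) / (2 * \<beta> - 1))"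
      using \<beta> by (subst geometric_sum) auto
    also have "2 * \<beta> - 1 = \<beta> * \<beta> ^ n"
      using \<beta>(3) by simp
    also have "\<beta> * (((2 * \<beta>) ^ n - 1) / (\<beta> * \<beta> ^ n)) = 2 ^ n - \<alpha> ^ n"
      using \<beta>(1) by (simp add: \<alpha>\<beta> field_simps power_mult_distrib)
    finally show ?thesis .
  qed
  moreover have "G sums (\<Sum>i<n. 2 ^ i * \<beta> ^ Suc i)"
    unfolding G_def by (intro sums_sum sums_mult sums)
  ultimately have C: "(\<lambda>k. C (Suc k)) sums (2 * (2 ^ n - \<alpha> ^ n - n / 2))"
    by (simp only:) (intro sums_mult, simp only: sums_Suc_iff diff_add_cancel)
  have "2 - \<alpha> = \<beta> ^ n"
    using \<alpha> by simp
  then have inverse_gap: "1 / (2 - \<alpha>) = \<alpha> ^ n"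
    by (simp only: \<alpha>\<beta> power_one_over)
  show ?thesis
    unfolding inverse_gap using A B C \<alpha> by (auto simp: sums_iff diff_divide_distrib)
qed

end
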